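(* Let $K$ be a field (with the standing assumption on $\mathrm{char}(K)$ given in the context) and let $I\subset S=K[x_1,\dots,x_n]$ be a polymatroidal ideal. Then $\partial(I)$ is polymatroidal.
   Context: $S=K[x_1,\dots,x_n]$ is the standard graded polynomial ring over the field $K$. For a homogeneous ideal $I\subset S$, the gradient ideal $\partial(I)$ is the ideal generated by all partial derivatives $\partial f/\partial x_i$ ($1\le i\le n$) of the elements $f$ of a minimal generating set of $I$. For a monomial ideal $I$, $\mathcal{G}(I)$ denotes its minimal monomial generating set, and $\mathrm{supp}(u)=\{i: x_i \text{ divides } u\}$ for a monomial $u$. Standing assumption: $\mathrm{char}(K)=0$, or $\mathrm{char}(K)$ is large enough that for every monomial ideal $I$ under consideration $$\partial(I)=(u/x_i:\ u\in\mathcal{G}(I),\ i\in\mathrm{supp}(u)).$$ For ${\bf a}\in\mathbb{Z}_{\ge0}^n$ put $|{\bf a}|=a_1+\dots+a_n$; vectors are compared componentwise, and ${\bf u}\vee{\bf v}$ is the componentwise maximum. A discrete polymatroid on $[n]=\{1,\dots,n\}$ is a nonempty finite set $P\subset\mathbb{Z}_{\ge0}^n$ such that (1) if ${\bf u}\in P$ and ${\bf v}\in\mathbb{Z}^n_{\ge0}$ with ${\bf v}\le{\bf u}$, then ${\bf v}\in P$; (2) if ${\bf u},{\bf v}\in P$ with $|{\bf u}|<|{\bf v}|$, then there is ${\bf w}\in P$ with ${\bf u}<{\bf w}\le{\bf u}\vee{\bf v}$. The bases of $P$ are its maximal elements with respect to $\le$. A monomial ideal $I\subset S$ is polymatroidal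 if the exponent vectors of the monomials in $\mathcal{G}(I)$ form the set of bases of a discrete polymatroid. By convention the zero ideal is also regarded as polymatroidal (this is relevant only for $I=0$ and $I=S$). *)

theory Defs
  imports Complex_Main "HOL-Library.Poly_Mapping"
begin

global_interpretation ideal: module "(*) :: 'a::comm_ring_1 \<Rightarrow> 'a \<Rightarrow> 'a"
  defines gen_ideal = ideal.span
  by unfold_locales (simp_all add: algebra_simps)

text \<open>The polynomial ring \<open>K[x\<^sub>1, \<dots>, x\<^sub>n]\<close> has its variables indexed by a finite type \<open>'n\<close>.\<close>

type_synonym 'n expo = "'n \<Rightarrow>\<^sub>0 nat"
type_synonym ('n, 'k) mpoly = "('n \<Rightarrow>\<^sub>0 nat) \<Rightarrow>\<^sub>0 'k"

definition monomial :: "'n expo \<Rightarrow> ('n, 'k::comm_ring_1) mpoly" where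
  "monomial a = Poly_Mapping.single a 1"

definition expo_degree :: "('n::finite) expo \<Rightarrow> nat" where
  "expo_degree a = (\<Sum>i\<in>UNIV. Poly_Mapping.lookup a i)"

definition homogeneous :: "('n::finite, 'k::comm_ring_1) mpoly \<Rightarrow> bool" where
  "homogeneous f \<longleftrightarrow> (\<exists>d. \<forall>a\<in>Poly_Mapping.keys f. expo_degree a = d)"

text \<open>The subtraction in the exponent truncates only where the coefficient vanishes.\<close>

definition partial_deriv :: "'n \<Rightarrow> ('n, 'k::comm_ring_1) mpoly \<Rightarrow> ('n, 'k) mpoly" where
  "partial_deriv i f =
     (\<Sum>a\<in>Poly_Mapping.keys f.
        Poly_Mapping.single (a - Poly_Mapping.single i 1)
          (of_nat (Poly_Mapping.lookup a i) * Poly_Mapping.lookup f a))"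

definition minimal_generating_set :: "'a::comm_ring_1 set \<Rightarrow> 'a set \<Rightarrow> bool" where
  "minimal_generating_set I F \<longleftrightarrow> gen_ideal F = I \<and> (\<forall>H. H \<subset> F \<longrightarrow> gen_ideal H \<noteq> I)"

text \<open>
  The gradient ideal of \<open>I\<close> is \<^term>\<open>gradient_ideal F\<close>, where \<open>F\<close> is a minimal
  generating set of \<open>I\<close> consisting of homogeneous polynomials.  For inhomogeneous \<open>F\<close> the
  ideal would depend on \<open>F\<close> even in characteristic zero.
\<close>

definition gradient_ideal :: "('n::finite, 'k::field) mpoly set \<Rightarrow> ('n, 'k) mpoly set" where
  "gradient_ideal F = gen_ideal {partial_deriv i f | i f. f \<in> F}"

definition monomial_ideal :: "('n::finite, 'k::field) mpoly set \<Rightarrow> bool" where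
  "monomial_ideal I \<longleftrightarrow> (\<exists>M \<subseteq> range monomial. I = gen_ideal M)"

text \<open>Well defined for monomial ideals, see \<open>ex1_minimal_monomial_gens\<close> below.\<close>

definition minimal_monomial_gens :: "('n::finite, 'k::field) mpoly set \<Rightarrow> ('n, 'k) mpoly set" where
  "minimal_monomial_gens I = (THE G. G \<subseteq> range monomial \<and> minimal_generating_set I G)"

text \<open>Vectors are functions \<^typ>\<open>'n \<Rightarrow> nat\<close>, so that \<open>\<le>\<close>, \<open><\<close> and \<^const>\<open>sup\<close>
  are the componentwise order and the componentwise maximum.\<close>

definition discrete_polymatroid :: "('n::finite \<Rightarrow> nat) set \<Rightarrow> bool" where
  "discrete_polymatroid P \<longleftrightarrow>
     P \<noteq> {} \<and> finite P \<and>
     (\<forall>u\<in>P. \<forall>v. v \<le> u \<longrightarrow> v \<in> P) \<and>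
     (\<forall>u\<in>P. \<forall>v\<in>P. sum u UNIV < sum v UNIV \<longrightarrow> (\<exists>w\<in>P. u < w \<and> w \<le> sup u v))"

definition polymatroid_bases :: "('n::finite \<Rightarrow> nat) set \<Rightarrow> ('n \<Rightarrow> nat) set" where
  "polymatroid_bases P = {u \<in> P. \<not> (\<exists>v\<in>P. u < v)}"

definition polymatroidal :: "('n::finite, 'k::field) mpoly set \<Rightarrow> bool" where
  "polymatroidal I \<longleftrightarrow> monomial_ideal I \<and>
     (I = {0} \<or>
      (\<exists>P. discrete_polymatroid P \<and>
           {Poly_Mapping.lookup a | a. monomial a \<in> minimal_monomial_gens I} = polymatroid_bases P))"

lemma keys_in_monomial_span:
  fixes x :: "('n::finite, 'k::field) mpoly"
  assumes "x \<in> gen_ideal (monomial ` B)" "c \<in> Poly_Mapping.keys x"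
  shows "\<exists>b\<in>B. \<exists>d. c = b + d"
  using assms
proof (induction arbitrary: c rule: ideal.span_induct_alt)
  case base
  then show ?case by simp
next
  case (step p m y)
  then obtain b where b: "b \<in> B" "m = monomial b" by auto
  have "c \<in> Poly_Mapping.keys (p * m) \<or> c \<in> Poly_Mapping.keys y"
    using step.prems Poly_Mapping.keys_add[of "p * m" y] by blast
  then show ?case
  proof
    assume "c \<in> Poly_Mapping.keys (p * m)"
    then obtain d e where "c = d + e" "e \<in> Poly_Mapping.keys m"
      using Poly_Mapping.keys_mult[of p m] by blast
    then have "c = b + d" using b by (simp add: monomial_def add.commute split: if_splits)
    with b show ?thesis by blast
  qed (use step.IH in blast)
qed

lemma monomial_in_span_iff:
  "(monomial c :: ('n::finite, 'k::field) mpoly) \<in> gen_ideal (monomial ` B) \<longleftrightarrow> (\<exists>b\<in>B. \<exists>d. c = b + d)"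
proof
  assume "(monomial c :: ('n, 'k) mpoly) \<in> gen_ideal (monomial ` B)"
  then show "\<exists>b\<in>B. \<exists>d. c = b + d"
    by (rule keys_in_monomial_span) (simp add: monomial_def)
next
  assume "\<exists>b\<in>B. \<exists>d. c = b + d"
  then obtain b d where bd: "b \<in> B" "c = b + d" by blast
  have "(monomial c :: ('n, 'k) mpoly) = monomial d * monomial b"
    by (simp add: bd monomial_def mult_single add.commute)
  then show "(monomial c :: ('n, 'k) mpoly) \<in> gen_ideal (monomial ` B)"
    using bd by (auto intro: ideal.span_scale ideal.span_base)
qed

lemma expo_degree_add: "expo_degree (a + b) = expo_degree a + expo_degree b"
  by (simp add: expo_degree_def lookup_add sum.distrib)

lemma expo_degree_eq_0: "expo_degree a = 0 \<longleftrightarrow> a = 0"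
  by (auto simp: expo_degree_def intro!: poly_mapping_eqI)

lemma expo_antisym:
  fixes a b :: "('n::finite) expo"
  assumes "a = b + d" "b = a + e"
  shows "a = b"
proof -
  have "expo_degree d = 0"
    using arg_cong[OF assms(1), of expo_degree] arg_cong[OF assms(2), of expo_degree]
    by (simp add: expo_degree_add)
  then show ?thesis using assms by (simp add: expo_degree_eq_0)
qed

lemma inj_monomial: "inj (monomial :: _ \<Rightarrow> ('n::finite, 'k::field) mpoly)"
proof (rule injI)
  fix a b :: "'n expo"
  assume "(monomial a :: ('n, 'k) mpoly) = monomial b"
  then have "Poly_Mapping.keys (monomial a :: ('n, 'k) mpoly) = Poly_Mapping.keys (monomial b :: ('n, 'k) mpoly)"
    by simp
  then show "a = b" by (simp add: monomial_def)
qed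

lemma ideal_eqI: "A \<subseteq> gen_ideal B \<Longrightarrow> B \<subseteq> gen_ideal A \<Longrightarrow> gen_ideal A = gen_ideal B"
  by (meson ideal.span_minimal ideal.subspace_span subset_antisym)

lemma minimal_gens_subset:
  fixes I :: "('n::finite, 'k::field) mpoly set"
  assumes A: "minimal_generating_set I (monomial ` A)" and B: "minimal_generating_set I (monomial ` B)"
  shows "A \<subseteq> B"
proof
  fix a assume a: "a \<in> A"
  have IA: "gen_ideal (monomial ` A) = I" and IB: "gen_ideal (monomial ` B) = I"
    using A B by (auto simp: minimal_generating_set_def)
  have "(monomial a :: ('n, 'k) mpoly) \<in> I" using a IA by (auto intro: ideal.span_base)
  then obtain b d where b: "b \<in> B" "a = b + d" using IB monomial_in_span_iff by blast
  have "(monomial b :: ('n, 'k) mpoly) \<in> I" using b IB by (auto intro: ideal.span_base)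
  then obtain a' d' where a': "a' \<in> A" "b = a' + d'" using IA monomial_in_span_iff by blast
  have "a' = a"
  proof (rule ccontr)
    assume ne: "a' \<noteq> a"
    let ?H = "monomial ` (A - {a}) :: ('n, 'k) mpoly set"
    have "(monomial a :: ('n, 'k) mpoly) \<in> gen_ideal ?H"
      unfolding monomial_in_span_iff using a' b ne by (auto simp: add.assoc)
    then have "monomial ` A \<subseteq> gen_ideal ?H" by (auto intro: ideal.span_base)
    moreover have "?H \<subseteq> gen_ideal (monomial ` A)" by (auto intro: ideal.span_base)
    ultimately have "gen_ideal ?H = I" using IA ideal_eqI by blast
    moreover have "monomial a \<notin> ?H" using inj_image_mem_iff[OF inj_monomial] by blast
    then have "?H \<subset> monomial ` A" using a by blast
    ultimately show False using A by (auto simp: minimal_generating_set_def)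
  qed
  then have "a = b" using a' b expo_antisym by metis
  then show "a \<in> B" using b by simp
qed

lemma ex1_minimal_monomial_gens:
  fixes I :: "('n::finite, 'k::field) mpoly set"
  assumes "monomial_ideal I"
  shows "\<exists>!G. G \<subseteq> range monomial \<and> minimal_generating_set I G"
proof -
  obtain B where IB: "I = gen_ideal (monomial ` B)"
    using assms unfolding monomial_ideal_def by (auto simp: subset_image_iff)
  define B0 where "B0 = {b \<in> B. \<forall>c\<in>B. \<forall>d. b = c + d \<longrightarrow> c = b}"
  have below: "\<exists>b\<in>B0. \<exists>d. c = b + d" if "c \<in> B" for c
    using that
  proof (induction "expo_degree c" arbitrary: c rule: less_induct)
    case less
    show ?case
    proof (cases "c \<in> B0")
      case True
      then show ?thesis by (metis add.right_neutral)
    next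
      case False
      then obtain b d where b: "b \<in> B" "c = b + d" "b \<noteq> c" using less.prems B0_def by blast
      then have "d \<noteq> 0" by auto
      then have "expo_degree b < expo_degree c"
        using b expo_degree_eq_0[of d] by (simp add: expo_degree_add)
      then obtain b' e where "b' \<in> B0" "b = b' + e" using less.hyps b by blast
      then show ?thesis using b by (metis add.assoc)
    qed
  qed
  have "gen_ideal (monomial ` B0) = I"
    unfolding IB
  proof (rule ideal_eqI)
    show "monomial ` B0 \<subseteq> gen_ideal (monomial ` B :: ('n, 'k) mpoly set)"
      by (auto simp: B0_def intro: ideal.span_base)
    show "monomial ` B \<subseteq> gen_ideal (monomial ` B0 :: ('n, 'k) mpoly set)"
      using below by (auto simp: monomial_in_span_iff)
  qed
  moreover have "gen_ideal H \<noteq> I" if H: "H \<subset> monomial ` B0" for H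
  proof
    assume HI: "gen_ideal H = I"
    obtain C where C: "H = monomial ` C" "C \<subseteq> B0" using H by (metis psubset_imp_subset subset_imageE)
    then obtain b where b: "b \<in> B0" "b \<notin> C" using H by blast
    have "(monomial b :: ('n, 'k) mpoly) \<in> I"
      using b IB B0_def by (auto intro: ideal.span_base)
    then have "(monomial b :: ('n, 'k) mpoly) \<in> gen_ideal (monomial ` C)" using HI C by simp
    then obtain c d where "c \<in> C" "b = c + d" unfolding monomial_in_span_iff by auto
    then show False using b C unfolding B0_def by force
  qed
  ultimately have min: "minimal_generating_set I (monomial ` B0)"
    by (auto simp: minimal_generating_set_def)
  show ?thesis
  proof (rule ex1I[of _ "monomial ` B0"])
    show "monomial ` B0 \<subseteq> range monomial \<and> minimal_generating_set I (monomial ` B0)" using min by auto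
  next
    fix G assume G: "G \<subseteq> range monomial \<and> minimal_generating_set I G"
    then obtain C where C: "G = monomial ` C" by (auto simp: subset_image_iff)
    then show "G = monomial ` B0" using G min minimal_gens_subset by blast
  qed
qed

text \<open>In particular every monomial ideal has a minimal generating set of homogeneous polynomials.\<close>

lemma minimal_monomial_gens:
  fixes I :: "('n::finite, 'k::field) mpoly set"
  assumes "monomial_ideal I"
  shows "minimal_monomial_gens I \<subseteq> range monomial" 
    and "minimal_generating_set I (minimal_monomial_gens I)"
    and "\<forall>f \<in> minimal_monomial_gens I. homogeneous f"
proof -
  have *: "minimal_monomial_gens I \<subseteq> range monomial \<and>
      minimal_generating_set I (minimal_monomial_gens I)"
    unfolding minimal_monomial_gens_def
    by (rule theI'[OF ex1_minimal_monomial_gens[OF assms]])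
  then show "minimal_monomial_gens I \<subseteq> range monomial" 
    and "minimal_generating_set I (minimal_monomial_gens I)" by auto
  show "\<forall>f \<in> minimal_monomial_gens I. homogeneous f"
    using * by (auto simp: homogeneous_def monomial_def)
qed

end

theory Submission
  imports Defs
begin

text \<open>
  A discrete polymatroid \<open>P\<close> whose bases have degree \<open>d > 0\<close> can be truncated: the vectors of
  \<open>P\<close> of degree at most \<open>d - 1\<close> again form a discrete polymatroid, since the exchange property
  allows one to raise a single coordinate at a time.  The bases of the truncation are the vectors
  of \<open>P\<close> of degree \<open>d - 1\<close>.  By the exchange property each of them extends to a basis of \<open>P\<close>, so
  they are precisely the vectors \<open>u - e\<^sub>i\<close> with \<open>u\<close> a basis and \<open>u\<^sub>i > 0\<close>
  (\<open>polymatroid_bases_lowered\<close>).  These are the exponents of the monomials \<open>u/x\<^sub>i\<close>, which all have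
  the same degree and therefore form the minimal monomial generating set of the ideal that they
  generate (\<open>minimal_monomial_gens_eqI\<close>).

  It remains to see that the gradient ideal is generated by the monomials \<open>u/x\<^sub>i\<close> when \<open>K\<close> has
  characteristic zero, whichever homogeneous minimal generating set it is computed from.  The
  product rule shows that the derivatives of an element of \<open>I\<close> are combinations of the generators
  \<open>g\<close> and of their derivatives; by Euler's identity \<open>\<Sum>\<^sub>i x\<^sub>i \<partial>g/\<partial>x\<^sub>i = deg(g) g\<close> each
  generator of positive degree lies in the ideal of its own derivatives.  Hence the gradient ideal
  does not depend on the generators of a proper ideal \<open>I\<close> (\<open>gradient_ideal_unique\<close>), and it can
  be computed from the minimal monomial ones.  Euler's identity says nothing about constants, so the
  unit ideal is treated separately: there a homogeneous minimal generating set consists of one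
  nonzero constant, and the gradient ideal vanishes.
\<close>

section \<open>Partial derivatives of polynomials\<close>

text \<open>The definition of \<^const>\<open>partial_deriv\<close> sums over the support of \<open>f\<close>, which behaves badly
  under addition.  Comparing coefficients instead makes additivity evident.\<close>

lemma lookup_partial_deriv:
  "Poly_Mapping.lookup (partial_deriv i f) c =
     of_nat (Poly_Mapping.lookup c i + 1) * Poly_Mapping.lookup f (c + Poly_Mapping.single i 1)"
proof -
  let ?e = "Poly_Mapping.single i (1::nat)"
  have eq: "Poly_Mapping.lookup (Poly_Mapping.single (a - ?e)
        (of_nat (Poly_Mapping.lookup a i) * Poly_Mapping.lookup f a)) c =
      (if a = c + ?e then of_nat (Poly_Mapping.lookup c i + 1) * Poly_Mapping.lookup f (c + ?e) else 0)"
    for a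
  proof (cases "Poly_Mapping.lookup a i = 0")
    case True
    then have "a \<noteq> c + ?e" by (auto simp: lookup_add)
    with True show ?thesis by simp
  next
    case False
    have "a - ?e + ?e = a"
      using False by (intro poly_mapping_eqI) (auto simp: lookup_add lookup_minus lookup_single when_def)
    then have "a - ?e = c \<longleftrightarrow> a = c + ?e" by (metis add_diff_cancel_right')
    then show ?thesis by (auto simp: lookup_single when_def lookup_add)
  qed
  have "Poly_Mapping.lookup (partial_deriv i f) c =
      (\<Sum>a\<in>Poly_Mapping.keys f. if a = c + ?e
         then of_nat (Poly_Mapping.lookup c i + 1) * Poly_Mapping.lookup f (c + ?e) else 0)"
    unfolding partial_deriv_def lookup_sum eq ..
  then show ?thesis by (simp add: in_keys_iff)
qed

lemma partial_deriv_0 [simp]: "partial_deriv i 0 = 0"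
  by (simp add: partial_deriv_def)

lemma partial_deriv_add: "partial_deriv i (f + g) = partial_deriv i f + partial_deriv i g"
  by (rule poly_mapping_eqI) (simp only: lookup_partial_deriv lookup_add ring_distribs)

lemma partial_deriv_single:
  "partial_deriv i (Poly_Mapping.single a x) =
     Poly_Mapping.single (a - Poly_Mapping.single i 1) (of_nat (Poly_Mapping.lookup a i) * x)"
  by (cases "x = 0") (simp_all add: partial_deriv_def)

lemma poly_mapping_sum_monomials:
  fixes f :: "'a \<Rightarrow>\<^sub>0 'b::comm_monoid_add"
  shows
  "(\<Sum>a\<in>Poly_Mapping.keys f. Poly_Mapping.single a (Poly_Mapping.lookup f a)) = f"
  by (rule poly_mapping_eqI) (auto simp: lookup_sum lookup_single when_def in_keys_iff)

lemma poly_mapping_single_add_induct [case_names zero single_add]: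
  fixes f :: "'a \<Rightarrow>\<^sub>0 'b::comm_monoid_add"
  assumes "P 0" and "\<And>a x f. P f \<Longrightarrow> P (Poly_Mapping.single a x + f)"
  shows "P f"
proof -
  have "P (\<Sum>a\<in>A. Poly_Mapping.single a (Poly_Mapping.lookup f a))" if "finite A" for A
    using that by induction (use assms in auto)
  then show ?thesis by (metis finite_keys poly_mapping_sum_monomials)
qed

text \<open>Where an exponent of the differentiated variable is \<open>0\<close>, the truncated subtraction gives a
  wrong exponent, but the coefficient vanishes as well.\<close>

lemma partial_deriv_mult_single:
  "partial_deriv i (Poly_Mapping.single a x * Poly_Mapping.single b y) =
     partial_deriv i (Poly_Mapping.single a x) * Poly_Mapping.single b y +
     Poly_Mapping.single a x * partial_deriv i (Poly_Mapping.single b y)"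
proof -
  let ?e = "Poly_Mapping.single i (1::nat)"
  have "a + b - ?e = a - ?e + b" if "Poly_Mapping.lookup a i \<noteq> 0"
    using that by (intro poly_mapping_eqI) (auto simp: lookup_add lookup_minus lookup_single when_def)
  then have left: "Poly_Mapping.single (a + b - ?e) (of_nat (Poly_Mapping.lookup a i) * (x * y)) =
      partial_deriv i (Poly_Mapping.single a x) * Poly_Mapping.single b y"
    unfolding partial_deriv_single mult_single mult.assoc
    by (cases "Poly_Mapping.lookup a i = 0") (simp, simp only: simp_thms)
  have "a + b - ?e = a + (b - ?e)" if "Poly_Mapping.lookup b i \<noteq> 0"
    using that by (intro poly_mapping_eqI) (auto simp: lookup_add lookup_minus lookup_single when_def)
  then have right: "Poly_Mapping.single (a + b - ?e) (of_nat (Poly_Mapping.lookup b i) * (x * y)) =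
      Poly_Mapping.single a x * partial_deriv i (Poly_Mapping.single b y)"
    unfolding partial_deriv_single mult_single mult.left_commute[of x]
    by (cases "Poly_Mapping.lookup b i = 0") (simp, simp only: simp_thms)
  show ?thesis
    unfolding left[symmetric] right[symmetric]
    by (simp add: mult_single partial_deriv_single lookup_add distrib_right single_add)
qed

lemma partial_deriv_mult:
  "partial_deriv i (f * g) = partial_deriv i f * g + f * partial_deriv i g"
proof (induction f rule: poly_mapping_single_add_induct)
  case zero
  show ?case by simp
next
  case (single_add a x f)
  have "partial_deriv i (Poly_Mapping.single a x * g) =
      partial_deriv i (Poly_Mapping.single a x) * g + Poly_Mapping.single a x * partial_deriv i g"
    by (induction g rule: poly_mapping_single_add_induct)
       (simp_all add: partial_deriv_add partial_deriv_mult_single distrib_left)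
  with single_add.IH show ?case by (simp add: partial_deriv_add distrib_right)
qed

text \<open>Multiplying \<open>\<partial>f/\<partial>x\<^sub>i\<close> by \<open>x\<^sub>i\<close> restores each exponent \<open>a\<close> and scales its coefficient by
  \<open>a\<^sub>i\<close>; summing over \<open>i\<close> scales it by \<open>d\<close>.\<close>

lemma euler_identity:
  fixes f :: "('n::finite, 'k::comm_ring_1) mpoly"
  assumes "\<forall>a\<in>Poly_Mapping.keys f. expo_degree a = d"
  shows "(\<Sum>i\<in>UNIV. monomial (Poly_Mapping.single i 1) * partial_deriv i f) =
    Poly_Mapping.single 0 (of_nat d) * f"
proof -
  have mult_var: "monomial (Poly_Mapping.single i 1) * partial_deriv i f =
      (\<Sum>a\<in>Poly_Mapping.keys f.
         Poly_Mapping.single a (of_nat (Poly_Mapping.lookup a i) * Poly_Mapping.lookup f a))" for i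
    unfolding partial_deriv_def sum_distrib_left
  proof (rule sum.cong[OF refl])
    fix a :: "'n expo"
    have "Poly_Mapping.single i 1 + (a - Poly_Mapping.single i 1) = a"
      if "Poly_Mapping.lookup a i \<noteq> 0"
      using that by (intro poly_mapping_eqI) (auto simp: lookup_add lookup_minus lookup_single when_def)
    then show "monomial (Poly_Mapping.single i 1) * Poly_Mapping.single (a - Poly_Mapping.single i 1)
          (of_nat (Poly_Mapping.lookup a i) * Poly_Mapping.lookup f a) =
        Poly_Mapping.single a (of_nat (Poly_Mapping.lookup a i) * Poly_Mapping.lookup f a)"
      by (cases "Poly_Mapping.lookup a i = 0") (simp_all add: monomial_def mult_single)
  qed
  have sum_single: "(\<Sum>i\<in>A. Poly_Mapping.single a (h i)) = Poly_Mapping.single a (sum h A)"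
    for A :: "'n set" and a :: "'n expo" and h :: "'n \<Rightarrow> 'k"
    by (induction A rule: infinite_finite_induct) (simp_all add: single_add)
  have "(\<Sum>i\<in>UNIV. monomial (Poly_Mapping.single i 1) * partial_deriv i f) =
      (\<Sum>a\<in>Poly_Mapping.keys f. Poly_Mapping.single a
         ((\<Sum>i\<in>UNIV. of_nat (Poly_Mapping.lookup a i)) * Poly_Mapping.lookup f a))"
    unfolding mult_var by (subst sum.swap) (simp add: sum_single sum_distrib_right)
  also have "\<dots> = (\<Sum>a\<in>Poly_Mapping.keys f.
      Poly_Mapping.single 0 (of_nat d) * Poly_Mapping.single a (Poly_Mapping.lookup f a))"
    using assms
    by (intro sum.cong)
       (simp_all add: mult_single expo_degree_def del: single_of_nat flip: of_nat_sum)
  also have "\<dots> = Poly_Mapping.single 0 (of_nat d) * f"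
    by (simp add: poly_mapping_sum_monomials flip: sum_distrib_left)
  finally show ?thesis .
qed

section \<open>Gradient ideals in characteristic zero\<close>

lemma mem_gen_ideal_partial_derivs:
  fixes f :: "('n::finite, 'k::field) mpoly"
  assumes "CHAR('k) = 0" and "\<forall>a\<in>Poly_Mapping.keys f. expo_degree a = d" and "d > 0"
  shows "f \<in> gen_ideal (range (\<lambda>i. partial_deriv i f))"
proof -
  have "(of_nat d :: 'k) \<noteq> 0"
    using assms(1,3) by (simp add: of_nat_eq_0_iff_char_dvd)
  then have "f = Poly_Mapping.single 0 (inverse (of_nat d)) * (Poly_Mapping.single 0 (of_nat d) * f)"
    by (simp add: mult_single del: single_of_nat flip: mult.assoc)
  also have "\<dots> \<in> gen_ideal (range (\<lambda>i. partial_deriv i f))"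
    unfolding euler_identity[OF assms(2), symmetric]
    by (intro ideal.span_scale ideal.span_sum ideal.span_base) auto
  finally show ?thesis .
qed

lemma one_mem_gen_ideal_of_const:
  fixes f :: "('n::finite, 'k::field) mpoly"
  assumes "f \<noteq> 0" "\<forall>a\<in>Poly_Mapping.keys f. expo_degree a = 0"
  shows "1 \<in> gen_ideal {f}"
proof -
  from assms(1) obtain a where "a \<in> Poly_Mapping.keys f" by fastforce
  have keys: "Poly_Mapping.keys f \<subseteq> {0}" using assms(2) by (auto simp: expo_degree_eq_0)
  define c where "c = Poly_Mapping.lookup f 0"
  have f: "f = Poly_Mapping.single 0 c"
    using keys by (intro poly_mapping_eqI) (auto simp: c_def lookup_single when_def in_keys_iff)
  then have "c \<noteq> 0" using assms(1) by auto
  then have "1 = Poly_Mapping.single 0 (inverse c) * f" by (simp add: f mult_single)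
  then show ?thesis using ideal.span_scale ideal.span_base by (metis singletonI)
qed

text \<open>The elements that lie in the gradient ideal \<open>J\<close> of \<open>G\<close> together with all their derivatives are
  closed under addition and, by the product rule, under multiplication by arbitrary polynomials.
  Euler's identity puts \<open>G\<close> among them, hence the whole ideal generated by \<open>G\<close>.\<close>

lemma gradient_ideal_mono:
  fixes F G :: "('n::finite, 'k::field) mpoly set"
  assumes char: "CHAR('k) = 0" and hom: "\<forall>f\<in>G. homogeneous f" and proper: "1 \<notin> gen_ideal G"
    and F: "F \<subseteq> gen_ideal G"
  shows "gradient_ideal F \<subseteq> gradient_ideal G"
proof -
  have deriv: "partial_deriv i g \<in> gradient_ideal G" if "g \<in> G" for g i
    using that unfolding gradient_ideal_def by (intro ideal.span_base) blast
  have mem: "g \<in> gradient_ideal G" if g: "g \<in> G" for g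
  proof (cases "g = 0")
    case True
    then show ?thesis by (simp add: gradient_ideal_def ideal.span_zero)
  next
    case False
    obtain d where d: "\<forall>a\<in>Poly_Mapping.keys g. expo_degree a = d"
      using hom g by (auto simp: homogeneous_def)
    \<comment> \<open>a nonzero constant among the generators would generate the unit ideal\<close>
    have "d > 0"
      using one_mem_gen_ideal_of_const[of g] False d proper g ideal.span_mono[of "{g}" G]
      by (cases "d = 0") auto
    then have "g \<in> gen_ideal (range (\<lambda>i. partial_deriv i g))"
      using mem_gen_ideal_partial_derivs char d by blast
    also have "\<dots> \<subseteq> gradient_ideal G"
      unfolding gradient_ideal_def by (intro ideal.span_mono) (use g in auto)
    finally show ?thesis .
  qed
  have "f \<in> gradient_ideal G \<and> (\<forall>i. partial_deriv i f \<in> gradient_ideal G)" if "f \<in> gen_ideal G" for f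
    using that
  proof (induction rule: ideal.span_induct_alt)
    case base
    then show ?case by (simp add: gradient_ideal_def ideal.span_zero)
  next
    case (step p g f)
    then show ?case
      using mem[of g] deriv[of g]
      by (auto simp: gradient_ideal_def partial_deriv_add partial_deriv_mult
          intro!: ideal.span_add ideal.span_scale)
  qed
  then show ?thesis
    using F unfolding gradient_ideal_def[of F]
    by (intro ideal.span_minimal) (auto simp: gradient_ideal_def)
qed

text \<open>If no generator had a constant term, no element of the ideal would have one.  So some generator
  does; being homogeneous it is a nonzero constant, and by minimality there is no other generator.\<close>

lemma gradient_ideal_unit_ideal:
  fixes F :: "('n::finite, 'k::field) mpoly set"
  assumes "minimal_generating_set I F" "\<forall>f\<in>F. homogeneous f" "1 \<in> I"
  shows "gradient_ideal F = {0}"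
proof -
  have gen: "gen_ideal F = I" using assms(1) by (simp add: minimal_generating_set_def)
  have "\<exists>f\<in>F. 0 \<in> Poly_Mapping.keys f"
  proof (rule ccontr)
    assume no: "\<not> ?thesis"
    have "0 \<notin> Poly_Mapping.keys f" if "f \<in> gen_ideal F" for f
      using that
    proof (induction rule: ideal.span_induct_alt)
      case (step p g f)
      have "0 \<notin> Poly_Mapping.keys (p * g)"
      proof
        assume "0 \<in> Poly_Mapping.keys (p * g)"
        then obtain a b where "0 = a + b" "b \<in> Poly_Mapping.keys g"
          using Poly_Mapping.keys_mult[of p g] by blast
        then have "0 \<in> Poly_Mapping.keys g"
          by (metis add_eq_0_iff_both_eq_0 expo_degree_add expo_degree_eq_0)
        then show False using no step.hyps by blast
      qed
      then show ?case using step.IH Poly_Mapping.keys_add[of "p * g" f] by blast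
    qed simp
    then show False using gen assms(3) by force
  qed
  then obtain f where f: "f \<in> F" "0 \<in> Poly_Mapping.keys f" by blast
  then have const: "\<forall>a\<in>Poly_Mapping.keys f. expo_degree a = 0"
    using assms(2) unfolding homogeneous_def by (metis expo_degree_eq_0)
  then have "1 \<in> gen_ideal {f}" using f by (intro one_mem_gen_ideal_of_const) auto
  then have "g \<in> gen_ideal {f}" for g using ideal.span_scale[of 1 "{f}" g] by simp
  then have "gen_ideal {f} = I" using gen ideal.span_mono[of "{f}" F] f(1) by blast
  then have F: "F = {f}" using assms(1) f(1) unfolding minimal_generating_set_def by blast
  have "partial_deriv i f = 0" for i
    unfolding partial_deriv_def using const by (intro sum.neutral) (auto simp: expo_degree_eq_0)
  then have "{partial_deriv i f | i f. f \<in> F} = {0}" by (auto simp: F)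
  then show ?thesis using ideal.span_eq_iff[of "{0}"]
    by (simp add: gradient_ideal_def ideal.subspace_single_0)
qed

lemma gradient_ideal_unique:
  fixes F G :: "('n::finite, 'k::field) mpoly set"
  assumes "CHAR('k) = 0"
    and "minimal_generating_set I F" "\<forall>f\<in>F. homogeneous f"
    and "minimal_generating_set I G" "\<forall>f\<in>G. homogeneous f"
  shows "gradient_ideal F = gradient_ideal G"
proof (cases "1 \<in> I")
  case True
  then show ?thesis using assms gradient_ideal_unit_ideal by metis
next
  case False
  have "gen_ideal F = I" "gen_ideal G = I"
    using assms by (auto simp: minimal_generating_set_def)
  then show ?thesis
    using assms False by (intro subset_antisym gradient_ideal_mono) (auto intro: ideal.span_base)
qed

text \<open>In characteristic zero the derivative of the monomial \<open>u\<close> by a variable \<open>x\<^sub>i\<close> dividing it is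
  \<open>u/x\<^sub>i\<close> times a unit.\<close>

lemma gradient_ideal_monomials:
  fixes A :: "('n::finite) expo set"
  assumes "CHAR('k::field) = 0"
  shows "gradient_ideal (monomial ` A :: ('n, 'k) mpoly set) =
    gen_ideal {monomial (a - Poly_Mapping.single i 1) | a i. a \<in> A \<and> i \<in> Poly_Mapping.keys a}"
  (is "_ = gen_ideal ?D")
proof -
  have deriv: "partial_deriv i (monomial a :: ('n, 'k) mpoly) =
      Poly_Mapping.single 0 (of_nat (Poly_Mapping.lookup a i)) *
        monomial (a - Poly_Mapping.single i 1)" for a i
    by (simp add: monomial_def partial_deriv_single mult_single del: single_of_nat)
  show ?thesis
    unfolding gradient_ideal_def
  proof (intro ideal_eqI subsetI)
    fix g :: "('n, 'k) mpoly"
    assume "g \<in> {partial_deriv i f | i f. f \<in> monomial ` A}"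
    then obtain i a where a: "a \<in> A" and g: "g = partial_deriv i (monomial a)" by blast
    show "g \<in> gen_ideal ?D"
    proof (cases "Poly_Mapping.lookup a i = 0")
      case True
      then show ?thesis by (simp add: g deriv ideal.span_zero)
    next
      case False
      then have "i \<in> Poly_Mapping.keys a" by (simp add: in_keys_iff)
      with a have "monomial (a - Poly_Mapping.single i 1) \<in> ?D" by blast
      then show ?thesis unfolding g deriv by (intro ideal.span_scale ideal.span_base)
    qed
  next
    fix g :: "('n, 'k) mpoly"
    assume "g \<in> ?D"
    then obtain i a where ai: "a \<in> A" "i \<in> Poly_Mapping.keys a"
      and g: "g = monomial (a - Poly_Mapping.single i 1)" by blast
    let ?m = "of_nat (Poly_Mapping.lookup a i) :: 'k"
    have "?m \<noteq> 0" using ai(2) assms by (simp add: of_nat_eq_0_iff_char_dvd in_keys_iff)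
    then have "g = Poly_Mapping.single 0 (inverse ?m) * partial_deriv i (monomial a)"
      by (simp add: deriv g mult_single del: single_of_nat flip: mult.assoc)
    also have "\<dots> \<in> gen_ideal {partial_deriv i f | i f. f \<in> monomial ` A}"
      using ai(1) by (intro ideal.span_scale ideal.span_base) blast
    finally show "g \<in> gen_ideal {partial_deriv i f | i f. f \<in> monomial ` A}" .
  qed
qed

section \<open>Truncation of discrete polymatroids\<close>

text \<open>A vector \<open>w\<close> given by the exchange property may exceed \<open>u\<close> in many places; lowering it until it
  exceeds \<open>u\<close> by one unit stays in \<open>P\<close>, because \<open>P\<close> is closed downwards.\<close>

lemma discrete_polymatroid_exchange_one:
  fixes P :: "('n::finite \<Rightarrow> nat) set"
  assumes P: "discrete_polymatroid P" and uv: "u \<in> P" "v \<in> P" "sum u UNIV < sum v UNIV"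
  shows "\<exists>i. u(i := Suc (u i)) \<in> P \<and> u i < v i"
proof -
  obtain w where w: "w \<in> P" "u < w" "w \<le> sup u v"
    using P uv unfolding discrete_polymatroid_def by meson
  then obtain i where i: "u i < w i" by (auto simp: Orderings.less_fun_def le_fun_def not_le)
  have "u(i := Suc (u i)) \<le> w" using w(2) i by (auto simp: Orderings.less_fun_def le_fun_def)
  then have "u(i := Suc (u i)) \<in> P" using P w(1) unfolding discrete_polymatroid_def by blast
  moreover have "w i \<le> sup (u i) (v i)" using w(3) by (auto simp: le_fun_def)
  then have "u i < v i" using i by (auto simp: sup_nat_def)
  ultimately show ?thesis by blast
qed

lemma sum_fun_upd_Suc:
  "sum (u(i := Suc (u i))) (UNIV :: 'n::finite set) = Suc (sum u UNIV)"
  by (simp add: sum.remove[of UNIV i])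

lemma sum_strict_mono_fun:
  fixes u v :: "'n::finite \<Rightarrow> nat"
  assumes "u < v"
  shows "sum u UNIV < sum v UNIV"
  using assms by (intro sum_strict_mono_ex1) (auto simp: Orderings.less_fun_def le_fun_def not_le)

lemma discrete_polymatroid_truncation:
  assumes P: "discrete_polymatroid P"
  shows "discrete_polymatroid {u \<in> P. sum u UNIV \<le> k}"
  unfolding discrete_polymatroid_def
proof (intro conjI ballI allI impI)
  obtain u where "u \<in> P" using P by (auto simp: discrete_polymatroid_def)
  then have "(\<lambda>_. 0) \<in> P" using P unfolding discrete_polymatroid_def by (metis le_funI le0)
  then show "{u \<in> P. sum u UNIV \<le> k} \<noteq> {}" by (auto intro!: exI[of _ "\<lambda>_. 0"])
  show "finite {u \<in> P. sum u UNIV \<le> k}" using P by (simp add: discrete_polymatroid_def)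
next
  fix u v assume "u \<in> {u \<in> P. sum u UNIV \<le> k}" "v \<le> u"
  then show "v \<in> {u \<in> P. sum u UNIV \<le> k}"
    using P sum_mono[of UNIV v u] unfolding discrete_polymatroid_def
    by (metis (mono_tags, lifting) le_funD le_trans mem_Collect_eq)
next
  fix u v assume u: "u \<in> {u \<in> P. sum u UNIV \<le> k}" and v: "v \<in> {u \<in> P. sum u UNIV \<le> k}"
    and less: "sum u UNIV < sum v UNIV"
  then obtain i where i: "u(i := Suc (u i)) \<in> P" "u i < v i"
    using discrete_polymatroid_exchange_one[OF P] by blast
  have "u(i := Suc (u i)) \<in> {u \<in> P. sum u UNIV \<le> k}"
    using i v less sum_fun_upd_Suc[of u i] by (simp del: fun_upd_apply)
  moreover have "u < u(i := Suc (u i))" by (auto simp: Orderings.less_fun_def le_fun_def)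
  moreover have "u(i := Suc (u i)) \<le> sup u v" using i by (auto simp: le_fun_def sup_nat_def)
  ultimately show "\<exists>w\<in>{u \<in> P. sum u UNIV \<le> k}. u < w \<and> w \<le> sup u v" by blast
qed

lemma polymatroid_bases_eq_degree:
  assumes P: "discrete_polymatroid P" and v: "v \<in> P" and max: "\<forall>u\<in>P. sum u UNIV \<le> sum v UNIV"
  shows "polymatroid_bases P = {u \<in> P. sum u UNIV = sum v UNIV}"
proof -
  have "\<exists>w\<in>P. u < w" if "u \<in> P" "sum u UNIV \<noteq> sum v UNIV" for u
    using P v max that unfolding discrete_polymatroid_def by (meson le_neq_implies_less)
  moreover have "\<not> u < w" if "w \<in> P" "sum u UNIV = sum v UNIV" for u w
    using sum_strict_mono_fun[of u w] max that by auto
  ultimately show ?thesis unfolding polymatroid_bases_def by blast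
qed

text \<open>If the bases of \<open>P\<close> have degree \<open>d + 1\<close>, the truncation of \<open>P\<close> at degree \<open>d\<close> has the required
  bases: exchange against a basis \<open>v\<close> of \<open>P\<close> raises each vector of degree \<open>d\<close> to a basis by one
  unit.  The excluded case is \<open>P = {0}\<close>, where no coordinate can be lowered.\<close>

lemma polymatroid_bases_lowered:
  assumes P: "discrete_polymatroid P" and bases: "polymatroid_bases P \<noteq> {\<lambda>_. 0}"
  obtains Q d where "discrete_polymatroid Q" "\<forall>u\<in>polymatroid_bases Q. sum u UNIV = d"
    and "polymatroid_bases Q = {u(i := u i - 1) | u i. u \<in> polymatroid_bases P \<and> u i > 0}"
proof -
  let ?S = "\<lambda>u. sum u UNIV :: nat"
  have finP: "finite P" "P \<noteq> {}" using P by (auto simp: discrete_polymatroid_def)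
  obtain v where v: "v \<in> P" "\<forall>u\<in>P. ?S u \<le> ?S v"
    using Max_in[of "?S ` P"] Max_ge[of "?S ` P"] finP by fastforce
  have basesP: "polymatroid_bases P = {u \<in> P. ?S u = ?S v}"
    by (rule polymatroid_bases_eq_degree[OF P v])
  have "?S v \<noteq> 0"
  proof
    assume 0: "?S v = 0"
    then have "u = (\<lambda>_. 0)" if "u \<in> P" for u
      using v(2) that by fastforce
    then have "P = {\<lambda>_. 0}" using finP by blast
    then show False using bases basesP v 0 by auto
  qed
  then obtain d where d: "?S v = Suc d" by (cases "?S v") auto
  define Q where "Q = {u \<in> P. ?S u \<le> d}"
  have Q: "discrete_polymatroid Q"
    unfolding Q_def by (rule discrete_polymatroid_truncation[OF P])
  have lower: "u(i := u i - 1) \<in> P \<and> ?S (u(i := u i - 1)) = d"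
    if "u \<in> P" "?S u = Suc d" "u i > 0" for u i
  proof
    have "u(i := u i - 1) \<le> u" by (auto simp: le_fun_def)
    then show "u(i := u i - 1) \<in> P" using P that(1) unfolding discrete_polymatroid_def by blast
    show "?S (u(i := u i - 1)) = d"
      using that(2,3) sum_fun_upd_Suc[of "u(i := u i - 1)" i] by simp
  qed
  obtain i where "v i > 0" using d by (metis sum.neutral gr0I nat.distinct(1))
  then have "\<exists>w. w \<in> P \<and> ?S w = d" using lower v(1) d by blast
  then obtain w where w: "w \<in> Q" "?S w = d" by (auto simp: Q_def)
  then have "polymatroid_bases Q = {u \<in> Q. ?S u = ?S w}"
    by (intro polymatroid_bases_eq_degree[OF Q]) (simp_all add: Q_def)
  also have "\<dots> = {u \<in> P. ?S u = d}" unfolding w(2) Q_def by auto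
  finally have basesQ: "polymatroid_bases Q = {u \<in> P. ?S u = d}" .
  have lowered: "{u \<in> P. ?S u = d} = {u(i := u i - 1) | u i. u \<in> P \<and> ?S u = Suc d \<and> u i > 0}"
  proof (intro equalityI subsetI)
    fix u assume u: "u \<in> {u \<in> P. ?S u = d}"
    then obtain i where i: "u(i := Suc (u i)) \<in> P"
      using discrete_polymatroid_exchange_one[OF P _ v(1)] d by auto
    let ?u = "u(i := Suc (u i))"
    have "?S ?u = Suc d" using u sum_fun_upd_Suc[of u i] by (simp del: fun_upd_apply)
    moreover have "u = ?u(i := ?u i - 1)" "?u i > 0" by simp_all
    ultimately show "u \<in> {u(i := u i - 1) | u i. u \<in> P \<and> ?S u = Suc d \<and> u i > 0}"
      using i by blast
  qed (use lower in blast)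
  show thesis
  proof (rule that[OF Q, of d])
    show "\<forall>u\<in>polymatroid_bases Q. ?S u = d" by (simp add: basesQ)
    show "polymatroid_bases Q = {u(i := u i - 1) | u i. u \<in> polymatroid_bases P \<and> u i > 0}"
      unfolding basesP basesQ d lowered by blast
  qed
qed

section \<open>Polymatroidal ideals\<close>

lemma monomial_ideal_gen_ideal: "monomial_ideal (gen_ideal (monomial ` D))"
  unfolding monomial_ideal_def by (intro exI[of _ "monomial ` D"]) auto

text \<open>No monomial properly divides another one of the same degree, so no generator is redundant.\<close>

lemma minimal_monomial_gens_eqI:
  fixes D :: "('n::finite) expo set"
  assumes "\<forall>a\<in>D. expo_degree a = d"
  shows "minimal_monomial_gens (gen_ideal (monomial ` D) :: ('n, 'k::field) mpoly set) = monomial ` D"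
proof -
  let ?I = "gen_ideal (monomial ` D) :: ('n, 'k) mpoly set"
  have "gen_ideal H \<noteq> ?I" if H: "H \<subset> monomial ` D" for H
  proof
    assume HI: "gen_ideal H = ?I"
    obtain C where C: "H = monomial ` C" "C \<subseteq> D" using H by (metis psubset_imp_subset subset_imageE)
    then obtain b where b: "b \<in> D" "b \<notin> C" using H by blast
    then have "(monomial b :: ('n, 'k) mpoly) \<in> gen_ideal (monomial ` C)"
      using HI C(1) ideal.span_base[of "monomial b" "monomial ` D"] by auto
    then obtain c e where c: "c \<in> C" "b = c + e" unfolding monomial_in_span_iff by auto
    then have "expo_degree e = 0" using assms b C(2) by (metis add_cancel_left_right expo_degree_add subsetD)
    then show False using c b by (simp add: expo_degree_eq_0)
  qed
  then have min: "minimal_generating_set ?I (monomial ` D)"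
    by (auto simp: minimal_generating_set_def)
  from ex1_minimal_monomial_gens[OF monomial_ideal_gen_ideal] show ?thesis
    unfolding minimal_monomial_gens_def by (rule the1_equality) (intro conjI image_mono subset_UNIV min)
qed

lemma polymatroidal_monomial_idealI:
  fixes D :: "('n::finite) expo set"
  assumes "discrete_polymatroid P" "Poly_Mapping.lookup ` D = polymatroid_bases P"
    and "\<forall>a\<in>D. expo_degree a = d"
  shows "polymatroidal (gen_ideal (monomial ` D) :: ('n, 'k::field) mpoly set)"
proof -
  have "{Poly_Mapping.lookup a | a. (monomial a :: ('n, 'k) mpoly) \<in> monomial ` D} =
      Poly_Mapping.lookup ` D"
    by (auto simp: inj_image_mem_iff[OF inj_monomial])
  then show ?thesis
    using assms(1,2) monomial_ideal_gen_ideal[of D]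
    unfolding polymatroidal_def minimal_monomial_gens_eqI[OF assms(3)] by metis
qed

lemma polymatroidal_zero: "polymatroidal {0}"
  unfolding polymatroidal_def monomial_ideal_def by (metis empty_subsetI ideal.span_empty)

theorem theorem3p1:
  fixes I F :: "('n::finite, 'k::field) mpoly set"
  assumes "polymatroidal I"
    and "minimal_generating_set I F"
    and "\<forall>f\<in>F. homogeneous f"
    and "CHAR('k) = 0 \<or>
         gradient_ideal F =
           gen_ideal {monomial (a - Poly_Mapping.single i 1) | a i.
                    monomial a \<in> minimal_monomial_gens I \<and> i \<in> Poly_Mapping.keys a}"
  shows "polymatroidal (gradient_ideal F)"
proof -
  have mon: "monomial_ideal I" using assms(1) by (simp add: polymatroidal_def)
  define A where "A = {a. (monomial a :: ('n, 'k) mpoly) \<in> minimal_monomial_gens I}"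
  have gens: "minimal_monomial_gens I = monomial ` A"
    using minimal_monomial_gens(1)[OF mon] by (auto simp: A_def)
  define D where "D = {a - Poly_Mapping.single i 1 | a i. a \<in> A \<and> i \<in> Poly_Mapping.keys a}"
  have D: "{monomial (a - Poly_Mapping.single i 1) | a i. a \<in> A \<and> i \<in> Poly_Mapping.keys a} =
      (monomial ` D :: ('n, 'k) mpoly set)" by (auto simp: D_def)
  have grad: "gradient_ideal F = gen_ideal (monomial ` D)"
    using assms(4)
  proof
    assume char: "CHAR('k) = 0"
    then have "gradient_ideal F = gradient_ideal (monomial ` A)"
      using gradient_ideal_unique assms(2,3) minimal_monomial_gens(2,3)[OF mon] gens by metis
    then show ?thesis unfolding gradient_ideal_monomials[OF char] D .
  qed (use D in \<open>simp add: A_def\<close>)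
  show ?thesis
  proof (cases "D = {}")
    \<comment> \<open>this case covers both the zero ideal and the unit ideal\<close>
    case True
    then show ?thesis using grad by (simp add: polymatroidal_zero)
  next
    case False
    then obtain a i where a: "a \<in> A" "i \<in> Poly_Mapping.keys a" by (auto simp: D_def)
    have "I \<noteq> {0}"
    proof
      assume "I = {0}"
      moreover have "monomial a \<in> I"
        using a(1) minimal_monomial_gens(2)[OF mon]
        by (auto simp: A_def minimal_generating_set_def intro: ideal.span_base)
      ultimately have "(monomial a :: ('n, 'k) mpoly) = 0" by simp
      then show False by (metis monomial_def lookup_single_eq lookup_zero one_neq_zero)
    qed
    moreover have "{Poly_Mapping.lookup a | a. monomial a \<in> minimal_monomial_gens I} =
        Poly_Mapping.lookup ` A"
      by (auto simp: A_def)
    ultimately obtain P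
      where P: "discrete_polymatroid P" "polymatroid_bases P = Poly_Mapping.lookup ` A"
      using assms(1) unfolding polymatroidal_def by metis
    have "polymatroid_bases P \<noteq> {\<lambda>_. 0}"
      using a P(2) by (metis imageI in_keys_iff singletonD)
    then obtain Q d where Q: "discrete_polymatroid Q" "\<forall>u\<in>polymatroid_bases Q. sum u UNIV = d"
      and basesQ: "polymatroid_bases Q = {u(i := u i - 1) | u i. u \<in> polymatroid_bases P \<and> u i > 0}"
      by (rule polymatroid_bases_lowered[OF P(1)])
    have lookup: "Poly_Mapping.lookup (a - Poly_Mapping.single i 1) =
        (Poly_Mapping.lookup a)(i := Poly_Mapping.lookup a i - 1)" for a :: "'n expo" and i
      by (auto simp: lookup_minus lookup_single when_def)
    have "Poly_Mapping.lookup ` D = {Poly_Mapping.lookup (a - Poly_Mapping.single i 1) | a i.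
        a \<in> A \<and> Poly_Mapping.lookup a i > 0}"
      by (auto simp: D_def in_keys_iff)
    also have "\<dots> = polymatroid_bases Q"
      unfolding basesQ P(2) lookup by blast
    finally have D_bases: "Poly_Mapping.lookup ` D = polymatroid_bases Q" .
    have "\<forall>a\<in>D. expo_degree a = d"
      using Q(2) unfolding expo_degree_def D_bases[symmetric] by blast
    then show ?thesis
      unfolding grad by (rule polymatroidal_monomial_idealI[OF Q(1) D_bases])
  qed
qed

end
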